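(* Let $G$ be a minimally $1$-tough, claw-free graph on $n\ge 4$ vertices. Then $G$ is (isomorphic to) the cycle $C_n$.
   Context: All graphs are finite, simple and undirected. The graph $K_{1,3}$ is called a claw; a graph is claw-free if it does not contain a claw as an induced subgraph. For a graph $G$, $\omega(G)$ denotes the number of connected components of $G$. A cutset of $G$ is a set $S\subseteq V(G)$ such that $G-S$ is disconnected, i.e. $\omega(G-S)\ge 2$. For a positive real number $t$, a graph $G$ is called $t$-tough if $\omega(G-S)\le |S|/t$ for every cutset $S$ of $G$. The toughness $\tau(G)$ is the largest $t$ for which $G$ is $t$-tough, with $\tau(K_n)=\infty$ for all $n\ge 1$ (and $\tau(G)=0$ if $G$ is disconnected). A graph $G$ is minimally $t$-tough if $\tau(G)=t$ and $\tau(G-e)<t$ for every $e\in E(G)$. $C_n$ denotes the cycle on $n$ vertices. *)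

theory Defs
  imports
    "Graph_Theory.Graph_Theory"
    "HOL-Library.Extended_Real"
begin

text \<open>
  Finite simple undirected graphs are the graphs of \<^locale>\<open>graph\<close>: finite symmetric digraphs
  without loops and parallel arcs, in which an undirected edge is a pair of opposite arcs. The
  strongly connected components of such a digraph are its connected components.
\<close>

definition num_components :: "('a, 'b) pre_digraph \<Rightarrow> nat" where
  "num_components G = card (pre_digraph.sccs G)"

definition del_verts :: "('a, 'b) pre_digraph \<Rightarrow> 'a set \<Rightarrow> ('a, 'b) pre_digraph" where
  "del_verts G S = G \<restriction> (verts G - S)"

text \<open>Deleting the undirected edge that contains the arc \<open>e\<close> removes both of its arcs.\<close>

definition del_edge :: "('a, 'b) pre_digraph \<Rightarrow> 'b \<Rightarrow> ('a, 'b) pre_digraph" where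
  "del_edge G e = G\<lparr>arcs := {a \<in> arcs G. {tail G a, head G a} \<noteq> {tail G e, head G e}}\<rparr>"

definition cutset :: "('a, 'b) pre_digraph \<Rightarrow> 'a set \<Rightarrow> bool" where
  "cutset G S \<longleftrightarrow> S \<subseteq> verts G \<and> num_components (del_verts G S) \<ge> 2"

definition tough :: "real \<Rightarrow> ('a, 'b) pre_digraph \<Rightarrow> bool" where
  "tough t G \<longleftrightarrow> (\<forall>S. cutset G S \<longrightarrow> real (num_components (del_verts G S)) \<le> real (card S) / t)"

text \<open>
  For a connected graph that is not complete the maximum in the last case exists: it is the minimum
  of \<open>card S / num_components (del_verts G S)\<close> over the finitely many cutsets \<open>S\<close>.
\<close>

definition toughness :: "('a, 'b) pre_digraph \<Rightarrow> ereal" where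
  "toughness G =
    (if complete_digraph (card (verts G)) G then \<infinity>
     else if num_components G \<ge> 2 then 0
     else ereal (GREATEST t. t > 0 \<and> tough t G))"

definition minimally_tough :: "real \<Rightarrow> ('a, 'b) pre_digraph \<Rightarrow> bool" where
  "minimally_tough t G \<longleftrightarrow>
    toughness G = ereal t \<and> (\<forall>e \<in> arcs G. toughness (del_edge G e) < ereal t)"

definition claw_free :: "('a, 'b) pre_digraph \<Rightarrow> bool" where
  "claw_free G \<longleftrightarrow> \<not> (\<exists>H. induced_subgraph H G \<and> complete_bipartite_digraph 1 3 H)"

text \<open>The cycle on \<open>n\<close> vertices; meaningful for \<open>n \<ge> 3\<close>.\<close>

definition cycle_graph :: "nat \<Rightarrow> nat pair_pre_digraph" where
  "cycle_graph n = \<lparr>pverts = {0..<n},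
     parcs = {(i, j). i < n \<and> j < n \<and> (j = Suc i mod n \<or> i = Suc j mod n)}\<rparr>"

end

theory Submission
  imports Defs
begin

text \<open>
  The proof shows that a minimally 1-tough claw-free graph on at least four vertices has no
  triangle. Claw-freeness then leaves no room for three neighbours of a vertex, and 1-toughness
  forces connectedness and two neighbours for each vertex, so the graph is a connected 2-regular
  graph, that is, a cycle.

  Minimality provides, for each edge \<open>u v\<close>, a set \<open>S\<close> such that removing \<open>S\<close> and the edge leaves
  more than \<open>|S|\<close> components; since the graph itself is 1-tough, the edge is a bridge of the graph
  without \<open>S\<close>. A common neighbour \<open>z\<close> of \<open>u\<close> and \<open>v\<close> must belong to \<open>S\<close>. Two cases remain.

  If \<open>|S| \<ge> 2\<close>, then the incidences between \<open>S\<close> and the components of the graph without \<open>S\<close> are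
  counted twice. A vertex of \<open>S\<close> sees at most two components because of claw-freeness, a component
  sees at least two vertices of \<open>S\<close> because there is no cut vertex, and there are at least \<open>|S|\<close>
  components. So both bounds are attained everywhere (lemma \<open>exactly_two_incidences\<close>). The component
  of the bridge \<open>u v\<close> therefore has only one neighbour in \<open>S\<close> besides \<open>z\<close>. Its two halves
  then have so few attachments that one of \<open>u\<close>, \<open>v\<close> dominates the other (every neighbour of the
  dominated vertex is equal or adjacent to the dominating one), whereas
  \<open>dominated_neighbours\<close> would then deprive \<open>z\<close> of the second component that it sees
  (lemma \<open>large_edge_cut_no_triangle\<close>).

  If \<open>S = {z}\<close>, then \<open>z\<close> has further neighbours \<open>a\<close> and \<open>b\<close> in the two halves, for otherwise one
  half would be a single vertex and domination would reduce the graph to the triangle.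
  The edge \<open>z u\<close> now lies in two triangles, with third vertices \<open>v\<close> and \<open>a\<close>, so its own set \<open>S\<close> has
  at least two elements, which is the first case.

  Components enter only through labellings of the vertices that are constant along edges: the
  number of components is the largest number of labels of such a labelling. Merging the two ends of
  a bridge is then a relabelling, and the combinatorial argument can be carried out for
  a symmetric relation on a finite set.
\<close>

section \<open>Incidences between a separating set and the remaining components\<close>

definition constant_on_edges :: "('a \<times> 'a) set \<Rightarrow> 'a set \<Rightarrow> ('a \<Rightarrow> 'b) \<Rightarrow> bool" where
  "constant_on_edges E X c \<longleftrightarrow> (\<forall>x\<in>X. \<forall>y\<in>X. (x, y) \<in> E \<longrightarrow> c x = c y)"

lemma constant_on_edgesD:
  "constant_on_edges E X c \<Longrightarrow> (x, y) \<in> E \<Longrightarrow> x \<in> X \<Longrightarrow> y \<in> X \<Longrightarrow> c x = c y"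
  by (auto simp: constant_on_edges_def)

text \<open>
  The assumption \<open>tough\<close> is 1-toughness, with labellings in place of components. It includes the
  case of empty \<open>S\<close>, hence connectedness. Sets of vertices serve as labels, since
  a component can then be labelled by itself.
\<close>
locale one_tough_claw_free =
  fixes V :: "'a set" and E :: "('a \<times> 'a) set"
  assumes finite_V: "finite V"
    and edges_in_V: "E \<subseteq> V \<times> V"
    and sym_E: "sym E"
    and irrefl_E: "irrefl E"
    and tough: "\<lbrakk>S \<subseteq> V; constant_on_edges E (V - S) (c :: 'a \<Rightarrow> 'a set); 2 \<le> card (c ` (V - S))\<rbrakk>
        \<Longrightarrow> card (c ` (V - S)) \<le> card S"
    and claw_free: "\<lbrakk>(s, x) \<in> E; (s, y) \<in> E; (s, z) \<in> E; x \<noteq> y; y \<noteq> z; x \<noteq> z\<rbrakk>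
        \<Longrightarrow> (x, y) \<in> E \<or> (y, z) \<in> E \<or> (x, z) \<in> E"
begin

lemma E_sym: "(x, y) \<in> E \<Longrightarrow> (y, x) \<in> E"
  using sym_E by (auto simp: sym_def)

lemma E_irrefl: "(x, y) \<in> E \<Longrightarrow> x \<noteq> y"
  using irrefl_E by (auto simp: irrefl_def)

lemma E_in_V: "(x, y) \<in> E \<Longrightarrow> x \<in> V" "(x, y) \<in> E \<Longrightarrow> y \<in> V"
  using edges_in_V by auto

text \<open>
  There is no cut vertex: labelling the two separated parts differently gives two labels, and
  toughness bounds their number by \<open>card S\<close>.
\<close>
lemma separator_card_ge_2:
  assumes "S \<subseteq> V" "A \<subseteq> V - S" "A \<noteq> {}" "V - S - A \<noteq> {}"
    and no_edge: "\<And>x y. x \<in> A \<Longrightarrow> y \<in> V - S - A \<Longrightarrow> (x, y) \<notin> E"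
  shows "2 \<le> card S"
proof -
  define c :: "'a \<Rightarrow> 'a set" where "c x = (if x \<in> A then UNIV else {})" for x
  have "constant_on_edges E (V - S) c"
    unfolding constant_on_edges_def c_def using no_edge E_sym by (metis Diff_iff)
  moreover have "c ` (V - S) = {UNIV, {}}"
    using assms(2-4) unfolding c_def by (auto simp: image_iff)
  ultimately show ?thesis
    using tough[OF \<open>S \<subseteq> V\<close>, of c] by simp
qed

text \<open>
  Double counting of the pairs of a vertex of \<open>S\<close> and a label that it sees. Three labels at one
  vertex would give a claw, and the vertices of \<open>S\<close> that see a given label separate its class from
  the others. Hence \<open>2 * card S\<close> bounds the number of pairs from above and twice the number of labels
  bounds it from below, and the hypothesis \<open>le\<close> makes all the inequalities equalities.
\<close>
lemma exactly_two_incidences: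
  fixes m :: "'a \<Rightarrow> 'a set"
  assumes S: "S \<subseteq> V" and m: "constant_on_edges E (V - S) m"
    and le: "card S \<le> card (m ` (V - S))" and two: "2 \<le> card (m ` (V - S))"
  shows "s \<in> S \<Longrightarrow> card {l \<in> m ` (V - S). \<exists>x\<in>V - S. m x = l \<and> (s, x) \<in> E} = 2"
    and "l \<in> m ` (V - S) \<Longrightarrow> card {s \<in> S. \<exists>x\<in>V - S. m x = l \<and> (s, x) \<in> E} = 2"
proof -
  define L where "L = m ` (V - S)"
  define I where "I s l \<longleftrightarrow> (\<exists>x\<in>V - S. m x = l \<and> (s, x) \<in> E)" for s l
  have fin: "finite S" "finite L"
    using S finite_V by (auto simp: L_def intro: finite_subset)
  have at_most: "card {l \<in> L. I s l} \<le> 2" for s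
  proof (rule ccontr)
    assume "\<not> ?thesis"
    then have "3 \<le> card {l \<in> L. I s l}" by simp
    then obtain T where "T \<subseteq> {l \<in> L. I s l}" "card T = 3"
      by (meson obtain_subset_with_card_n)
    then obtain l1 l2 l3 where l: "I s l1" "I s l2" "I s l3" "l1 \<noteq> l2" "l2 \<noteq> l3" "l1 \<noteq> l3"
      by (auto simp: card_3_iff)
    then obtain x1 x2 x3 where "x1 \<in> V - S" "m x1 = l1" "(s, x1) \<in> E"
      "x2 \<in> V - S" "m x2 = l2" "(s, x2) \<in> E" "x3 \<in> V - S" "m x3 = l3" "(s, x3) \<in> E"
      unfolding I_def by metis
    then show False
      using claw_free[of s x1 x2 x3] constant_on_edgesD[OF m] l by metis
  qed
  have at_least: "2 \<le> card {s \<in> S. I s l}" if "l \<in> L" for l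
  proof (rule separator_card_ge_2)
    show "{s \<in> S. I s l} \<subseteq> V" using S by auto
    show "{x \<in> V - S. m x = l} \<subseteq> V - {s \<in> S. I s l}" by auto
    show "{x \<in> V - S. m x = l} \<noteq> {}" using that by (auto simp: L_def)
    have "\<not> L \<subseteq> {l}" using two card_mono[of "{l}" L] by (auto simp: L_def)
    then show "V - {s \<in> S. I s l} - {x \<in> V - S. m x = l} \<noteq> {}"
      by (auto simp: L_def)
    fix x y assume "x \<in> {x \<in> V - S. m x = l}" "y \<in> V - {s \<in> S. I s l} - {x \<in> V - S. m x = l}"
    then show "(x, y) \<notin> E"
      unfolding I_def using constant_on_edgesD[OF m, of x y] E_sym[of x y] by auto
  qed
  have double: "(\<Sum>s\<in>S. card {l \<in> L. I s l}) = (\<Sum>l\<in>L. card {s \<in> S. I s l})"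
    using sum_multicount_gen[of S L "\<lambda>s l. I s l"] fin by simp
  have "(\<Sum>s\<in>S. card {l \<in> L. I s l}) \<le> (\<Sum>s\<in>S. 2)"
    by (intro sum_mono at_most)
  moreover have "(\<Sum>l\<in>L. 2) \<le> (\<Sum>l\<in>L. card {s \<in> S. I s l})"
    by (intro sum_mono at_least)
  moreover have "card S \<le> card L" using le by (simp add: L_def)
  ultimately have
    eqs: "(\<Sum>s\<in>S. card {l \<in> L. I s l}) = (\<Sum>s\<in>S. 2)"
         "(\<Sum>l\<in>L. 2) = (\<Sum>l\<in>L. card {s \<in> S. I s l})"
    using double by simp_all
  show "card {l \<in> m ` (V - S). \<exists>x\<in>V - S. m x = l \<and> (s, x) \<in> E} = 2" if "s \<in> S"
    using sum_mono_inv[OF eqs(1) _ that fin(1)] at_most by (simp add: L_def I_def)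
  show "card {s \<in> S. \<exists>x\<in>V - S. m x = l \<and> (s, x) \<in> E} = 2" if "l \<in> m ` (V - S)"
    using sum_mono_inv[OF eqs(2) _ _ fin(2), of l] at_least that
    by (simp add: L_def I_def)
qed

section \<open>Edges whose deletion destroys toughness\<close>

text \<open>
  A witness that the graph without the edge \<open>u v\<close> is not 1-tough, normalised so that the two ends
  have different labels: \<open>u v\<close> is a bridge of the graph without \<open>S\<close>.
\<close>
definition edge_cut :: "'a \<Rightarrow> 'a \<Rightarrow> 'a set \<Rightarrow> ('a \<Rightarrow> 'a set) \<Rightarrow> bool" where
  "edge_cut u v S c \<longleftrightarrow> S \<subseteq> V \<and> u \<in> V - S \<and> v \<in> V - S \<and> c u \<noteq> c v \<and>
     constant_on_edges (E - {(u, v), (v, u)}) (V - S) c \<and> card S < card (c ` (V - S))"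

lemma edge_cut_same_label:
  assumes "edge_cut u v S c" "(x, y) \<in> E" "x \<in> V - S" "y \<in> V - S" "{x, y} \<noteq> {u, v}"
  shows "c x = c y"
  using assms constant_on_edgesD[of "E - {(u, v), (v, u)}" "V - S" c x y]
  unfolding edge_cut_def by auto

lemma common_neighbour_in_cut:
  assumes "edge_cut u v S c" "(u, z) \<in> E" "(v, z) \<in> E"
  shows "z \<in> S"
proof (rule ccontr)
  assume "z \<notin> S"
  then have "c u = c z" "c v = c z"
    using edge_cut_same_label[OF assms(1), of _ z] assms E_irrefl E_in_V
    by (auto simp: edge_cut_def doubleton_eq_iff)
  then show False using assms(1) by (simp add: edge_cut_def)
qed

text \<open>
  Restoring the edge joins the classes of \<open>u\<close> and \<open>v\<close> into the single class \<open>C\<close>. This costs only one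
  label, so at least \<open>card S\<close> labels remain and the exact count applies.
\<close>
lemma edge_cut_incidences:
  assumes cut: "edge_cut u v S c" and k: "2 \<le> card S"
  defines "C \<equiv> {x \<in> V - S. c x \<in> {c u, c v}}"
  shows "s \<in> S \<Longrightarrow> \<exists>d \<in> V - S - C. (s, d) \<in> E"
    and "card {s \<in> S. \<exists>x\<in>C. (s, x) \<in> E} = 2"
proof -
  \<comment> \<open>the label of \<open>v\<close> is replaced by that of \<open>u\<close>\<close>
  define m where "m x = (if c x = c v then c u else c x)" for x
  note cutD = cut[unfolded edge_cut_def]
  have m: "constant_on_edges E (V - S) m"
    unfolding constant_on_edges_def
  proof (intro ballI impI)
    fix x y assume "x \<in> V - S" "y \<in> V - S" "(x, y) \<in> E"
    then show "m x = m y"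
      using edge_cut_same_label[OF cut, of x y]
      by (cases "{x, y} = {u, v}") (auto simp: m_def doubleton_eq_iff)
  qed
  have "c ` (V - S) - {c v} \<subseteq> m ` (V - S)"
    by (auto simp: m_def image_iff)
  then have "card (c ` (V - S) - {c v}) \<le> card (m ` (V - S))"
    using finite_V by (intro card_mono) auto
  moreover have "card (c ` (V - S) - {c v}) = card (c ` (V - S)) - 1"
    using cutD by (intro card_Diff_singleton) auto
  ultimately have le: "card S \<le> card (m ` (V - S))" using cutD by linarith
  have C: "x \<in> C \<longleftrightarrow> m x = c u" if "x \<in> V - S" for x
    using that by (auto simp: C_def m_def)
  note two = exactly_two_incidences[OF _ m le]
  show "\<exists>d \<in> V - S - C. (s, d) \<in> E" if "s \<in> S"
  proof (rule ccontr)
    assume "\<not> ?thesis"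
    then have "{l \<in> m ` (V - S). \<exists>x\<in>V - S. m x = l \<and> (s, x) \<in> E} \<subseteq> {c u}"
      using C by blast
    then have "card {l \<in> m ` (V - S). \<exists>x\<in>V - S. m x = l \<and> (s, x) \<in> E} \<le> 1"
      using card_mono[of "{c u}"] by fastforce
    then show False using two(1)[OF _ _ that] cutD k le by simp
  qed
  have "c u \<in> m ` (V - S)" using cutD by (auto simp: m_def image_iff)
  then have "card {s \<in> S. \<exists>x\<in>V - S. m x = c u \<and> (s, x) \<in> E} = 2"
    using two(2)[of "c u"] cutD k le by simp
  moreover have "(\<exists>x\<in>V - S. m x = c u \<and> (s, x) \<in> E) \<longleftrightarrow> (\<exists>x\<in>C. (s, x) \<in> E)" for s
    using C by (auto simp: C_def)
  ultimately show "card {s \<in> S. \<exists>x\<in>C. (s, x) \<in> E} = 2" by simp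
qed

end

section \<open>Minimality excludes triangles\<close>

locale minimally_one_tough_claw_free = one_tough_claw_free +
  assumes minimal: "(u, v) \<in> E \<Longrightarrow>
      \<exists>S (c :: 'a \<Rightarrow> 'a set). S \<subseteq> V \<and> constant_on_edges (E - {(u, v), (v, u)}) (V - S) c \<and>
        2 \<le> card (c ` (V - S)) \<and> card S < card (c ` (V - S))"
    and order: "4 \<le> card V"
begin

text \<open>
  If \<open>u\<close> and \<open>v\<close> had the same label or one of them were in \<open>S\<close>, then the labelling would also be
  constant along all edges of the graph, contrary to toughness.
\<close>
lemma edge_cut_exists:
  assumes "(u, v) \<in> E"
  obtains S c where "edge_cut u v S c"
proof -
  obtain S and c :: "'a \<Rightarrow> 'a set" where
    S: "S \<subseteq> V" and c: "constant_on_edges (E - {(u, v), (v, u)}) (V - S) c" and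
    card: "2 \<le> card (c ` (V - S))" "card S < card (c ` (V - S))"
    using minimal[OF assms] by blast
  have "\<not> constant_on_edges E (V - S) c"
    using tough[OF S _ card(1)] card(2) by auto
  with c have "u \<in> V - S \<and> v \<in> V - S \<and> c u \<noteq> c v"
    unfolding constant_on_edges_def by (metis (no_types, lifting) Diff_iff insert_iff prod.inject singletonD)
  with S c card(2) have "edge_cut u v S c" by (simp add: edge_cut_def)
  then show thesis by (rule that)
qed

text \<open>
  Consider the cut \<open>S\<close> of the edge \<open>u s\<close>; it contains \<open>w\<close>. Every neighbour of \<open>w\<close> is \<open>u\<close> or adjacent
  to \<open>u\<close>, so \<open>w\<close> sees only the component of \<open>u\<close> and \<open>s\<close>, which the count forbids when \<open>S\<close> has at
  least two elements. So \<open>S = {w}\<close>, and since \<open>s\<close> is the only neighbour of \<open>w\<close> on its side of the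
  bridge, this side is \<open>{s}\<close> alone.
\<close>
lemma dominated_neighbours:
  assumes "(w, u) \<in> E" and dom: "\<And>x. (w, x) \<in> E \<Longrightarrow> x = u \<or> (u, x) \<in> E"
    and "(w, s) \<in> E" "s \<noteq> u" and "(s, x) \<in> E"
  shows "x \<in> {u, w}"
proof -
  have us: "(u, s) \<in> E" using assms(2)[OF assms(3)] assms(4) by simp
  obtain S c where cut: "edge_cut u s S c" using edge_cut_exists[OF us] .
  note cutD = cut[unfolded edge_cut_def]
  have wS: "w \<in> S"
    using common_neighbour_in_cut[OF cut] assms E_sym by blast
  have lab: "x = s \<or> c x = c u" if "(w, x) \<in> E" "x \<in> V - S" for x
    using dom[OF that(1)] that(2) edge_cut_same_label[OF cut, of u x] cutD
    by (auto simp: doubleton_eq_iff)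
  have "card S < 2"
  proof (rule ccontr)
    assume "\<not> ?thesis"
    then obtain d where "d \<in> V - S" "c d \<notin> {c u, c s}" "(w, d) \<in> E"
      using edge_cut_incidences(1)[OF cut _ wS] by auto
    then show False using lab by auto
  qed
  moreover have "finite S" using cutD finite_V by (auto intro: finite_subset)
  ultimately have S: "S = {w}" using wS
    by (metis One_nat_def card_1_singletonE card_gt_0_iff empty_iff less_2_cases not_less0 singletonD)
  define B where "B = {x \<in> V - S. c x \<noteq> c u}"
  have B: "B = {s}"
  proof (rule ccontr)
    assume "B \<noteq> {s}"
    have "2 \<le> card {s}"
    proof (rule separator_card_ge_2)
      show "{s} \<subseteq> V" "B - {s} \<subseteq> V - {s}" using E_in_V assms by (auto simp: B_def)
      show "B - {s} \<noteq> {}" using \<open>B \<noteq> {s}\<close> cutD by (auto simp: B_def)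
      show "V - {s} - (B - {s}) \<noteq> {}"
        using cutD E_irrefl[OF us] by (auto simp: B_def)
      fix x y assume x: "x \<in> B - {s}" and y: "y \<in> V - {s} - (B - {s})"
      show "(x, y) \<notin> E"
      proof
        assume xy: "(x, y) \<in> E"
        show False
        proof (cases "y = w")
          case True
          then show False using lab[of x] E_sym[OF xy] x by (auto simp: B_def)
        next
          case False
          then show False using edge_cut_same_label[OF cut xy] x y S
            by (auto simp: B_def doubleton_eq_iff)
        qed
      qed
    qed
    then show False by simp
  qed
  show ?thesis
  proof (rule ccontr)
    assume neg: "x \<notin> {u, w}"
    then have "x \<in> V - S" "x \<noteq> s" using E_in_V[OF assms(5)] E_irrefl[OF assms(5)] S by auto
    then have "c s = c x"
      using edge_cut_same_label[OF cut assms(5)] cutD neg by (auto simp: doubleton_eq_iff)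
    then show False using B \<open>x \<in> V - S\<close> \<open>x \<noteq> s\<close> cutD by (auto simp: B_def)
  qed
qed

text \<open>
  The component of the bridge \<open>u v\<close> has exactly two neighbours \<open>z\<close> and \<open>t\<close> in \<open>S\<close>. By claw-freeness
  \<open>z\<close> is adjacent to no vertex of the component other than \<open>u\<close> and \<open>v\<close>. If the side of \<open>u\<close> contains
  a further vertex, then \<open>t\<close> must be adjacent to such a vertex, for \<open>u\<close> is not a cut vertex; so \<open>t\<close>
  has no neighbour on the side of \<open>v\<close>, that side is \<open>{v}\<close>, and \<open>v\<close> has only the neighbours \<open>u\<close> and
  \<open>z\<close>. If both sides are trivial, then \<open>u\<close> and \<open>v\<close> have no neighbours except each other, \<open>z\<close> and
  \<open>t\<close>. In every case one of \<open>u\<close> and \<open>v\<close> dominates the other, and then \<open>dominated_neighbours\<close> leaves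
  \<open>z\<close> without a neighbour in a second component.
\<close>
lemma large_edge_cut_no_triangle:
  assumes cut: "edge_cut u v S c" and k: "2 \<le> card S"
    and uv: "(u, v) \<in> E" and uz: "(u, z) \<in> E" and vz: "(v, z) \<in> E"
  shows False
proof -
  note cutD = cut[unfolded edge_cut_def]
  define side where "side p = {x \<in> V - S. c x = c p}" for p
  have C: "{x \<in> V - S. c x \<in> {c u, c v}} = side u \<union> side v" unfolding side_def by blast
  have inc: "s \<in> S \<Longrightarrow> \<exists>d \<in> V - S - (side u \<union> side v). (s, d) \<in> E"
    "card {s \<in> S. \<exists>x\<in>side u \<union> side v. (s, x) \<in> E} = 2" for s
    using edge_cut_incidences[OF cut k] unfolding C by simp_all
  have sides: "u \<in> side u" "v \<in> side v" "side u \<inter> side v = {}"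
    using cutD unfolding side_def by simp_all blast
  have zS: "z \<in> S" using common_neighbour_in_cut[OF cut uz vz] .
  have bridge: "x = u \<and> y = v" if "x \<in> side u" "y \<in> side v" "(x, y) \<in> E" for x y
    using edge_cut_same_label[OF cut that(3)] that cutD
    by (auto simp: side_def doubleton_eq_iff)
  have outer: "(x, d) \<notin> E" "x \<noteq> d"
    if "x \<in> side u \<union> side v" "d \<in> V - S - (side u \<union> side v)" for x d
    using edge_cut_same_label[OF cut, of x d] that sides
    by (auto simp: side_def doubleton_eq_iff)
  \<comment> \<open>\<open>s\<close> also has a neighbour in another component, which completes a claw unless \<open>x y\<close> is the
    bridge\<close>
  have both_sides: "x = u \<and> y = v"
    if "s \<in> S" "x \<in> side u" "y \<in> side v" "(s, x) \<in> E" "(s, y) \<in> E" for s x y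
  proof -
    have "\<exists>d\<in>V - S - (side u \<union> side v). (s, d) \<in> E" using inc(1) that(1) .
    then obtain d where d: "d \<in> V - S - (side u \<union> side v)" "(s, d) \<in> E" by blast
    then show ?thesis
      using claw_free[OF that(4,5) d(2)] outer(1)[of x d] outer(1)[of y d] outer(2)[of x d]
        outer(2)[of y d] bridge[OF that(2,3)] that sides by blast
  qed
  obtain t where t: "{s \<in> S. \<exists>x\<in>side u \<union> side v. (s, x) \<in> E} = {z, t}"
  proof -
    obtain p q where "{s \<in> S. \<exists>x\<in>side u \<union> side v. (s, x) \<in> E} = {p, q}"
      using inc(2) by (auto simp: card_2_iff)
    moreover have "z \<in> {s \<in> S. \<exists>x\<in>side u \<union> side v. (s, x) \<in> E}"
      using zS sides E_sym[OF uz] by auto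
    ultimately show thesis using that[of p] that[of q] by auto
  qed
  then have tS: "t \<in> S" by blast
  \<comment> \<open>from here on \<open>p\<close> and \<open>q\<close> stand for \<open>u\<close> and \<open>v\<close> in either order\<close>
  have cases: "{p, q} = {u, v} \<Longrightarrow> p = u \<and> q = v \<or> p = v \<and> q = u" for p q
    by (auto simp: doubleton_eq_iff)
  have neighbours: "y \<in> side p \<or> x = p \<and> y \<in> {q, z} \<or> y = t"
    if pq: "{p, q} = {u, v}" and x: "x \<in> side p" and xy: "(x, y) \<in> E" for p q x y
  proof (cases "y \<in> S")
    case True
    have "x \<in> side u \<union> side v" using x cases[OF pq] by blast
    then have "y \<in> {s \<in> S. \<exists>x\<in>side u \<union> side v. (s, x) \<in> E}" using True xy E_sym by blast
    then have "y = z \<or> y = t" unfolding t by blast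
    moreover have "x = p" if "y = z"
      using cases[OF pq] both_sides[OF zS] x xy sides uz vz E_sym that by metis
    ultimately show ?thesis by blast
  next
    case False
    then show ?thesis
      using bridge[of x y] bridge[of y x] outer(1)[of x y] x xy E_in_V E_sym cases[OF pq] by blast
  qed
  have t_side: "\<exists>a\<in>side p - {p}. (t, a) \<in> E"
    if pq: "{p, q} = {u, v}" and nontrivial: "side p \<noteq> {p}" for p q
  proof (rule ccontr)
    assume no: "\<not> ?thesis"
    have pV: "p \<in> side p" "q \<in> V - side p" "p \<noteq> q"
      using cases[OF pq] sides cutD by (auto simp: side_def)
    have "2 \<le> card {p}"
    proof (rule separator_card_ge_2)
      show "{p} \<subseteq> V" "side p - {p} \<subseteq> V - {p}" using pV by (auto simp: side_def)
      show "side p - {p} \<noteq> {}" using nontrivial pV by auto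
      show "V - {p} - (side p - {p}) \<noteq> {}" using pV by auto
      fix x y assume "x \<in> side p - {p}" "y \<in> V - {p} - (side p - {p})"
      then show "(x, y) \<notin> E" using neighbours[OF pq, of x y] no E_sym[of x y] by blast
    qed
    then show False by simp
  qed
  have pq_edges: "(p, q) \<in> E" "(q, p) \<in> E" "(p, z) \<in> E" "(q, z) \<in> E"
    if "{p, q} = {u, v}" for p q
    using cases[OF that] uv uz vz E_sym by blast+
  have "\<exists>d\<in>V - S - (side u \<union> side v). (z, d) \<in> E" using inc(1) zS .
  then obtain d where d: "(z, d) \<in> E" "d \<noteq> u" "d \<noteq> v" using sides by blast
  have not_dominated: "\<exists>x. (q, x) \<in> E \<and> x \<noteq> p \<and> (p, x) \<notin> E" if pq: "{p, q} = {u, v}" for p q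
    using dominated_neighbours[of q p z d] pq_edges[OF pq] d cases[OF pq] E_irrefl by blast
  have trivial: "side p = {p}" if pq: "{p, q} = {u, v}" for p q
  proof (rule ccontr)
    assume "side p \<noteq> {p}"
    then obtain a where a: "a \<in> side p - {p}" "(t, a) \<in> E" using t_side[OF pq] by blast
    have qp: "{q, p} = {u, v}" using pq by blast
    have no: "y \<notin> side q" if "(t, y) \<in> E" for y
      using both_sides[OF tS, of a y] both_sides[OF tS, of y a] a that cases[OF pq] by blast
    then have "side q = {q}" using t_side[OF qp] by blast
    then have "(q, x) \<in> E \<Longrightarrow> x \<in> {p, z}" for x
      using neighbours[OF qp, of q x] no E_sym E_irrefl by blast
    then show False using not_dominated[OF pq] pq_edges[OF pq] by blast
  qed
  have vu: "{v, u} = {u, v}" by blast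
  have "x \<in> {v, z, t}" if "(u, x) \<in> E" for x
    using neighbours[of u v u x, OF refl sides(1) that] trivial[of u v] E_irrefl[OF that] by auto
  moreover have "x \<in> {u, z, t}" if "(v, x) \<in> E" for x
    using neighbours[OF vu sides(2) that] trivial[OF vu] E_irrefl[OF that] by auto
  ultimately show False
    using not_dominated[of u v] not_dominated[OF vu] uz vz by blast
qed

text \<open>
  By the preceding lemma the cut of \<open>u v\<close> is \<open>{z}\<close>. If \<open>z\<close> has further neighbours on both sides of
  the bridge, then \<open>z u\<close> has two common neighbours and hence a cut with at least two elements.
  If it has none on the side of \<open>u\<close>, say, then this side is \<open>{u}\<close>, as \<open>u\<close> is not a cut vertex;
  then \<open>v\<close> and \<open>z\<close> both dominate \<open>u\<close>, so that the triangle has no neighbours and is the whole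
  graph, which has too many vertices for this.
\<close>
lemma triangle_free:
  assumes uv: "(u, v) \<in> E" and uz: "(u, z) \<in> E"
  shows "(v, z) \<notin> E"
proof
  assume vz: "(v, z) \<in> E"
  obtain S c where cut: "edge_cut u v S c" using edge_cut_exists[OF uv] .
  note cutD = cut[unfolded edge_cut_def]
  have "z \<in> S" using common_neighbour_in_cut[OF cut uz vz] .
  moreover have fin: "finite S" using cutD finite_V by (auto intro: finite_subset)
  moreover have "card S < 2" using large_edge_cut_no_triangle[OF cut _ uv uz vz] by fastforce
  ultimately have S: "S = {z}"
    by (metis One_nat_def card_1_singletonE card_gt_0_iff empty_iff less_2_cases not_less0 singletonD)
  define A where "A = {x \<in> V - S. c x = c u}"
  define B where "B = {x \<in> V - S. c x \<noteq> c u}"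
  have AB: "u \<in> A" "v \<in> B" "A \<inter> B = {}" "A \<union> B = V - {z}"
    using cutD S by (auto simp: A_def B_def)
  have bridge: "x = u \<and> y = v" if "x \<in> A" "y \<in> B" "(x, y) \<in> E" for x y
    using edge_cut_same_label[OF cut that(3)] that cutD
    by (auto simp: A_def B_def doubleton_eq_iff)
  have zV: "z \<in> V" "z \<notin> A" "z \<notin> B" using E_in_V uz S by (auto simp: A_def B_def)
  have not_all: "V \<noteq> {p, q, z}" for p q
  proof
    assume "V = {p, q, z}"
    then have "card V \<le> 3" by (simp add: card_insert_if)
    then show False using order by simp
  qed
  \<comment> \<open>\<open>P\<close> is the side of \<open>p\<close>, for either assignment of the names to the two sides\<close>
  have nbr: "\<exists>a\<in>P - {p}. (z, a) \<in> E"
    if cases: "P = A \<and> Q = B \<and> p = u \<and> q = v \<or> P = B \<and> Q = A \<and> p = v \<and> q = u" for P Q p q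
  proof -
    have pq: "(p, q) \<in> E" "(q, p) \<in> E" "(p, z) \<in> E" "(q, z) \<in> E" "p \<in> P" "q \<in> Q"
      "P \<inter> Q = {}" "P \<union> Q = V - {z}"
      using cases uv uz vz AB E_sym by auto
    have br: "x = p \<and> y = q" if "x \<in> P" "y \<in> Q" "(x, y) \<in> E" for x y
      using bridge[of x y] bridge[of y x] cases that E_sym by blast
    have "P \<noteq> {p}"
    proof
      assume P: "P = {p}"
      have p: "x \<in> {q, z}" if "(p, x) \<in> E" for x
      proof -
        have "x = z \<or> x \<in> P \<or> x \<in> Q" using E_in_V(2)[OF that] pq(8) by blast
        then show ?thesis using br[OF pq(5) _ that] P E_irrefl[OF that] by auto
      qed
      then have "y \<in> {q, p}" if "(z, y) \<in> E" for y
        using dominated_neighbours[of p q z y] pq E_irrefl that by blast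
      moreover have "y \<in> {z, p}" if "(q, y) \<in> E" for y
        using dominated_neighbours[of p z q y] pq E_irrefl that E_sym p by blast
      ultimately have no: "(x, y) \<notin> E" if "x \<in> {p, q, z}" "y \<notin> {p, q, z}" for x y
        using that p by blast
      have "2 \<le> card ({} :: 'a set)"
        using not_all[of p q] pq zV no E_in_V
        by (intro separator_card_ge_2[of "{}" "{p, q, z}"]) blast+
      then show False by simp
    qed
    show ?thesis
    proof (rule ccontr)
      assume no: "\<not> ?thesis"
      have "2 \<le> card {p}"
      proof (rule separator_card_ge_2)
        show "{p} \<subseteq> V" "P - {p} \<subseteq> V - {p}" "P - {p} \<noteq> {}" "V - {p} - (P - {p}) \<noteq> {}"
          using pq \<open>P \<noteq> {p}\<close> by blast+
        fix x y assume "x \<in> P - {p}" "y \<in> V - {p} - (P - {p})"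
        then show "(x, y) \<notin> E" using br[of x y] no E_sym[of x y] pq by blast
      qed
      then show False by simp
    qed
  qed
  obtain a where a: "a \<in> A - {u}" "(z, a) \<in> E" using nbr[of A B u v] by blast
  obtain b where b: "b \<in> B - {v}" "(z, b) \<in> E" using nbr[of B A v u] by blast
  \<comment> \<open>otherwise \<open>u\<close>, \<open>a\<close> and \<open>b\<close> would form a claw with centre \<open>z\<close>\<close>
  have "(u, a) \<in> E"
    using claw_free[of z u a b] E_sym[OF uz] a b bridge[of u b] bridge[of a b] AB by blast
  obtain S' c' where cut': "edge_cut z u S' c'" using edge_cut_exists[OF E_sym[OF uz]] .
  have "{v, a} \<subseteq> S'"
    using common_neighbour_in_cut[OF cut'] uv E_sym[OF vz] a \<open>(u, a) \<in> E\<close> by blast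
  moreover have "finite S'" using cut' finite_V by (auto simp: edge_cut_def intro: finite_subset)
  ultimately have "card {v, a} \<le> card S'" by (simp add: card_mono)
  moreover have "v \<noteq> a" using a AB by blast
  ultimately have "2 \<le> card S'" by simp
  then show False
    using large_edge_cut_no_triangle[OF cut' _ E_sym[OF uz] E_sym[OF vz] uv] by simp
qed

text \<open>
  Three neighbours of a vertex are pairwise nonadjacent in a triangle-free graph and so form a claw;
  the neighbourhood of a vertex separates it from the remaining vertices, if there are any.
\<close>
lemma degree_eq_2:
  assumes "v \<in> V"
  shows "card {x. (v, x) \<in> E} = 2"
proof (rule antisym)
  have fin: "finite {x. (v, x) \<in> E}" and sub: "{x. (v, x) \<in> E} \<subseteq> V"
    using E_in_V finite_V by (auto intro: finite_subset[of _ V])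
  show "card {x. (v, x) \<in> E} \<le> 2"
  proof (rule ccontr)
    assume "\<not> ?thesis"
    then have "3 \<le> card {x. (v, x) \<in> E}" by simp
    then obtain T where "T \<subseteq> {x. (v, x) \<in> E}" "card T = 3"
      by (meson obtain_subset_with_card_n)
    then obtain x y z where "(v, x) \<in> E" "(v, y) \<in> E" "(v, z) \<in> E" "x \<noteq> y" "y \<noteq> z" "x \<noteq> z"
      by (auto simp: card_3_iff)
    then show False using claw_free triangle_free by metis
  qed
  show "2 \<le> card {x. (v, x) \<in> E}"
  proof (cases "V = insert v {x. (v, x) \<in> E}")
    case True
    then have "card V \<le> Suc (card {x. (v, x) \<in> E})"
      by (metis card_insert_le_m1 card_insert_if fin le_Suc_eq order_refl)
    then show ?thesis using order by simp
  next
    case False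
    show ?thesis
      using False sub assms E_irrefl
      by (intro separator_card_ge_2[of "{x. (v, x) \<in> E}" "{v}"]) blast+
  qed
qed

lemma connected:
  assumes "A \<subseteq> V" "A \<noteq> {}" "A \<noteq> V"
  obtains x y where "x \<in> A" "y \<in> V - A" "(x, y) \<in> E"
proof -
  have "\<not> 2 \<le> card ({} :: 'a set)" by simp
  then show thesis
    using separator_card_ge_2[of "{}" A] assms that by blast
qed

end

section \<open>Connected two-regular graphs are cycles\<close>

definition path_list :: "('a \<times> 'a) set \<Rightarrow> 'a list \<Rightarrow> bool" where
  "path_list E p \<longleftrightarrow> distinct p \<and> (\<forall>i. Suc i < length p \<longrightarrow> (p ! i, p ! Suc i) \<in> E)"

locale connected_two_regular =
  fixes V :: "'a set" and E :: "('a \<times> 'a) set"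
  assumes finite_V: "finite V" and nonempty: "V \<noteq> {}"
    and edges_in_V: "E \<subseteq> V \<times> V" and sym_E: "sym E" and irrefl_E: "irrefl E"
    and degree: "v \<in> V \<Longrightarrow> card {x. (v, x) \<in> E} = 2"
    and connected: "\<lbrakk>A \<subseteq> V; A \<noteq> {}; A \<noteq> V\<rbrakk> \<Longrightarrow> \<exists>x\<in>A. \<exists>y\<in>V - A. (x, y) \<in> E"
begin

lemma neighbours_eq:
  assumes "(v, x) \<in> E" "(v, y) \<in> E" "x \<noteq> y"
  shows "(v, z) \<in> E \<longleftrightarrow> z = x \<or> z = y"
proof -
  have "finite {x. (v, x) \<in> E}"
    using edges_in_V finite_V by (auto intro: finite_subset[of _ V])
  moreover have "card {x. (v, x) \<in> E} = card {x, y}"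
    using degree[of v] assms edges_in_V by auto
  ultimately have "{x, y} = {x. (v, x) \<in> E}"
    using assms by (intro card_subset_eq) auto
  then show ?thesis by blast
qed

text \<open>
  Some edge leaves the path by connectedness. It leaves from an end of the path, since the
  inner vertices already have both of their neighbours on it.
\<close>
lemma path_extends:
  assumes p: "path_list E p" "p \<noteq> []" "set p \<subset> V"
  shows "\<exists>q. path_list E q \<and> set q \<subseteq> V \<and> length q = Suc (length p)"
proof -
  obtain x y where xy: "x \<in> set p" "y \<in> V - set p" "(x, y) \<in> E"
    using connected[of "set p"] p by auto
  obtain i where i: "i < length p" "x = p ! i" using xy by (auto simp: in_set_conv_nth)
  have yx: "(y, x) \<in> E" using xy sym_E by (auto simp: sym_def)
  have dist: "distinct p" and step: "Suc j < length p \<Longrightarrow> (p ! j, p ! Suc j) \<in> E" for j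
    using p by (auto simp: path_list_def)
  consider "i = 0" | "Suc i = length p" | "0 < i" "Suc i < length p" using i by linarith
  then show ?thesis
  proof cases
    case 1
    then have "path_list E (y # p)"
      using xy(2) yx i dist step by (auto simp: path_list_def nth_Cons split: nat.split)
    then show ?thesis using xy p by (intro exI[of _ "y # p"]) auto
  next
    case 2
    have "path_list E (p @ [y])"
      unfolding path_list_def
    proof (intro conjI allI impI)
      show "distinct (p @ [y])" using xy dist by auto
      fix j assume "Suc j < length (p @ [y])"
      then consider "Suc j < length p" | "j = i" using 2 by fastforce
      then show "((p @ [y]) ! j, (p @ [y]) ! Suc j) \<in> E"
        using 2 step xy(3) i by cases (auto simp: nth_append)
    qed
    then show ?thesis using xy p by (intro exI[of _ "p @ [y]"]) auto
  next
    case 3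
    have "(x, p ! (i - 1)) \<in> E" "(x, p ! Suc i) \<in> E"
      using step[of "i - 1"] step[of i] 3 i sym_E by (auto simp: sym_def)
    moreover have "p ! (i - 1) \<noteq> p ! Suc i" using 3 dist by (simp add: nth_eq_iff_index_eq)
    ultimately have "y = p ! (i - 1) \<or> y = p ! Suc i" using neighbours_eq xy(3) by blast
    then show ?thesis using xy(2) 3 by auto
  qed
qed

lemma hamiltonian_path: "\<exists>p. path_list E p \<and> set p = V"
proof -
  have "\<exists>p. path_list E p \<and> set p \<subseteq> V \<and> length p = Suc k" if "Suc k \<le> card V" for k
    using that
  proof (induction k)
    case 0
    obtain v where "v \<in> V" using nonempty by blast
    then show ?case by (intro exI[of _ "[v]"]) (auto simp: path_list_def)
  next
    case (Suc k)
    then obtain p where p: "path_list E p" "set p \<subseteq> V" "length p = Suc k" by auto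
    then have "card (set p) = Suc k" using distinct_card[of p] by (simp add: path_list_def)
    then have "set p \<subset> V" using Suc.prems p(2) by auto
    moreover have "p \<noteq> []" using p(3) by auto
    ultimately show ?case using path_extends[OF p(1)] p(3) by simp
  qed
  moreover have "0 < card V" using finite_V nonempty by (simp add: card_gt_0_iff)
  ultimately obtain p where p: "path_list E p" "set p \<subseteq> V" "length p = card V"
    using gr0_implies_Suc[OF \<open>0 < card V\<close>] by (metis order_refl)
  then have "card (set p) = card V" using distinct_card[of p] by (simp add: path_list_def)
  then show ?thesis using p card_subset_eq[OF finite_V p(2)] by blast
qed

text \<open>
  On a Hamiltonian path, the second neighbour of the first vertex can only be the last one, because
  the neighbours of an inner vertex are those next to it on the path. So the path closes
  up to a cycle, whose edges already use up all the degrees.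
\<close>
lemma cyclic_enumeration:
  "\<exists>p. distinct p \<and> set p = V \<and> (\<forall>i<length p. \<forall>j<length p.
      (p ! i, p ! j) \<in> E \<longleftrightarrow> j = Suc i mod length p \<or> i = Suc j mod length p)"
proof -
  obtain p where p: "path_list E p" "set p = V" using hamiltonian_path by blast
  define n where "n = length p"
  have dist: "distinct p" and step: "Suc j < n \<Longrightarrow> (p ! j, p ! Suc j) \<in> E" for j
    using p by (auto simp: path_list_def n_def)
  have eq: "p ! i = p ! j \<longleftrightarrow> i = j" if "i < n" "j < n" for i j
    using that dist by (simp add: nth_eq_iff_index_eq n_def)
  have E_sym: "(x, y) \<in> E \<Longrightarrow> (y, x) \<in> E" for x y using sym_E by (auto simp: sym_def)
  have pV: "p ! i \<in> V" if "i < n" for i using that p by (auto simp: n_def)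
  have "0 < n" using nonempty p by (auto simp: n_def)
  then have deg0: "card {x. (p ! 0, x) \<in> E} = 2" using degree pV by simp
  have nbr: "\<exists>j<n. x = p ! j" if "(p ! 0, x) \<in> E" for x
  proof -
    have "x \<in> set p" using that edges_in_V p(2) by blast
    then show ?thesis by (metis in_set_conv_nth n_def)
  qed
  obtain a b where ab: "{x. (p ! 0, x) \<in> E} = {a, b}" "a \<noteq> b"
    using deg0 by (auto simp: card_2_iff)
  then have "(p ! 0, a) \<in> E" "(p ! 0, b) \<in> E" by blast+
  then obtain i j where ij: "i < n" "a = p ! i" "j < n" "b = p ! j" using nbr by metis
  have "i \<noteq> j" "i \<noteq> 0" "j \<noteq> 0"
    using ab ij irrefl_E by (auto simp: irrefl_def)
  then have n3: "3 \<le> n" using ij by linarith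
  have inner: "(p ! k, z) \<in> E \<longleftrightarrow> z = p ! (k - 1) \<or> z = p ! Suc k" if "0 < k" "Suc k < n" for k z
  proof (rule neighbours_eq)
    show "(p ! k, p ! (k - 1)) \<in> E" using step[of "k - 1"] that E_sym by simp
    show "(p ! k, p ! Suc k) \<in> E" using step that by simp
    show "p ! (k - 1) \<noteq> p ! Suc k" using eq that by simp
  qed
  have "\<exists>k<n. k \<noteq> 1 \<and> (p ! 0, p ! k) \<in> E"
    using ab ij \<open>i \<noteq> j\<close> by blast
  then obtain k where k: "k < n" "k \<noteq> 1" "(p ! 0, p ! k) \<in> E" by blast
  have "k \<noteq> 0" using k(3) irrefl_E by (metis irrefl_def)
  have "Suc k = n"
  proof (rule ccontr)
    assume "Suc k \<noteq> n"
    then have lt: "0 < k" "k - 1 < n" "Suc k < n" using k(1) \<open>k \<noteq> 0\<close> by linarith+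
    then have "p ! 0 = p ! (k - 1) \<or> p ! 0 = p ! Suc k"
      using inner[OF lt(1,3)] E_sym[OF k(3)] by blast
    then have "0 = k - 1 \<or> 0 = Suc k" using eq[OF \<open>0 < n\<close>] lt(2,3) by blast
    then show False using k(2) \<open>k \<noteq> 0\<close> by linarith
  qed
  then have closing: "(p ! (n - 1), p ! 0) \<in> E" using E_sym[OF k(3)] by auto
  have succ: "(p ! i, p ! (Suc i mod n)) \<in> E" if "i < n" for i
  proof (cases "Suc i = n")
    case True
    then show ?thesis using closing by auto
  next
    case False
    then show ?thesis using step[of i] that by simp
  qed
  have "(p ! i, p ! j) \<in> E \<longleftrightarrow> j = Suc i mod n \<or> i = Suc j mod n"
    if i: "i < n" and j: "j < n" for i j
  proof -
    \<comment> \<open>the cyclic predecessor of \<open>i\<close>\<close>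
    define h where "h = (if i = 0 then n - 1 else i - 1)"
    have h: "h < n" "Suc h mod n = i" "h \<noteq> Suc i mod n"
      using i n3 by (auto simp: h_def mod_Suc)
    have pred: "i = Suc j mod n \<longleftrightarrow> j = h"
      using i j n3 by (auto simp: h_def mod_Suc)
    have "(p ! i, p ! h) \<in> E" using succ[OF h(1)] h(2) E_sym by simp
    moreover have "p ! (Suc i mod n) \<noteq> p ! h" using eq[of "Suc i mod n" h] h n3 by simp
    ultimately have "(p ! i, p ! j) \<in> E \<longleftrightarrow> p ! j = p ! (Suc i mod n) \<or> p ! j = p ! h"
      using neighbours_eq[OF succ[OF i]] by blast
    then show ?thesis using eq[OF j] h(1) n3 pred by simp
  qed
  then show ?thesis using dist p(2) unfolding n_def by blast
qed

end

section \<open>Components, toughness and claws of graphs\<close>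

text \<open>
  A labelling that is constant along edges is constant on components, so its labels are determined
  by the components.
\<close>
lemma (in graph) card_labels_le_num_components:
  assumes c: "\<And>x y. x \<rightarrow>\<^bsub>G\<^esub> y \<Longrightarrow> c x = c y"
  shows "card (c ` verts G) \<le> num_components G"
proof -
  have const: "c x = c y" if "x \<rightarrow>\<^sup>* y" for x y
    using that by (induction) (auto simp: c)
  have "c ` verts G \<subseteq> (\<lambda>C. c (SOME x. x \<in> C)) ` sccs_verts"
  proof
    fix l assume "l \<in> c ` verts G"
    then obtain x where x: "x \<in> verts G" "l = c x" by blast
    then have "x \<in> scc_of x" by (rule_tac in_scc_of_self)
    then have "(SOME y. y \<in> scc_of x) \<in> scc_of x" by (rule someI)
    then have "c (SOME y. y \<in> scc_of x) = l" using const x(2) by (auto simp: scc_of_def)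
    then show "l \<in> (\<lambda>C. c (SOME x. x \<in> C)) ` sccs_verts"
      using scc_of_in_sccs_verts[OF x(1)] by blast
  qed
  then have "card (c ` verts G) \<le> card sccs_verts"
    by (rule surj_card_le[OF finite_sccs_verts])
  then show ?thesis by (simp add: num_components_def card_sccs_verts)
qed

lemma (in graph) scc_of_eq_if_adj:
  assumes "x \<rightarrow>\<^bsub>G\<^esub> y"
  shows "scc_of x = scc_of y"
proof -
  have "x \<rightarrow>\<^sup>* y" "y \<rightarrow>\<^sup>* x" using assms graph_symmetric by auto
  then show ?thesis by (auto simp: scc_of_def intro: reachable_trans)
qed

lemma (in graph) num_components_eq_card_scc_of: "num_components G = card (scc_of ` verts G)"
  by (simp add: num_components_def card_sccs_verts[symmetric] sccs_verts_conv_scc_of)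

lemma arcs_ends_del_verts:
  "arcs_ends (del_verts G S) = {(x, y) \<in> arcs_ends G. x \<in> verts G - S \<and> y \<in> verts G - S}"
  by (auto simp: arcs_ends_conv del_verts_def)

lemma verts_del_verts: "verts (del_verts G S) = verts G - S"
  by (simp add: del_verts_def)

lemma arcs_ends_del_edge:
  "arcs_ends (del_edge G e) =
    arcs_ends G - {(tail G e, head G e), (head G e, tail G e)}"
  by (auto simp: arcs_ends_conv del_edge_def doubleton_eq_iff)

lemma verts_del_edge [simp]: "verts (del_edge G e) = verts G"
  by (simp add: del_edge_def)

lemma (in graph) graph_induce:
  assumes "X \<subseteq> verts G"
  shows "graph (G \<restriction> X)"
proof -
  have "induced_subgraph (G \<restriction> X) G" using assms by (rule induced_induce)
  then show ?thesis
    using digraphI_induced induced_graph_imp_symmetric sym_arcs digraph.graphI by blast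
qed

lemma (in graph) graph_del_verts: "graph (del_verts G S)"
  unfolding del_verts_def by (rule graph_induce) auto

lemma (in graph) graph_del_edge: "graph (del_edge G e)"
proof -
  interpret D: digraph "del_edge G e"
    using finite_verts finite_arcs no_loops no_multi_arcs
    by unfold_locales (auto simp: del_edge_def arc_to_ends_def)
  have "symmetric (del_edge G e)"
    using sym_arcs unfolding symmetric_def arcs_ends_del_edge sym_def by blast
  then show ?thesis by (rule D.graphI)
qed

text \<open>
  The set over which the \<open>GREATEST\<close> in the definition of toughness ranges is
  \<open>{0<..Min R}\<close>, where \<open>R\<close> is the finite set of ratios of cutset size to number of components. \<open>R\<close> is
  nonempty because the graph is not complete, and its members are positive because the graph is
  connected.
\<close>
lemma (in graph) toughness_attained:
  assumes conn: "num_components G < 2" and ncomp: "\<not> complete_digraph (card (verts G)) G"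
  obtains T where "toughness G = ereal T" "T > 0" "\<And>t. t > 0 \<Longrightarrow> tough t G \<longleftrightarrow> t \<le> T"
proof -
  let ?w = "\<lambda>S. num_components (del_verts G S)"
  define R where "R = (\<lambda>S. real (card S) / real (?w S)) ` {S. cutset G S}"
  have "{S. cutset G S} \<subseteq> Pow (verts G)" by (auto simp: cutset_def)
  then have fin: "finite R" unfolding R_def by (intro finite_imageI) (auto intro: finite_subset)
  have "\<exists>x y. x \<in> verts G \<and> y \<in> verts G \<and> x \<noteq> y \<and> (x, y) \<notin> arcs_ends G"
  proof (rule ccontr)
    assume "\<not> ?thesis"
    then have "arcs_ends G = {(u, v). (u, v) \<in> verts G \<times> verts G \<and> u \<noteq> v}"
      using adj_in_verts adj_not_same by blast
    then show False using ncomp graph_axioms by (simp add: complete_digraph_def)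
  qed
  then obtain x y where xy: "x \<in> verts G" "y \<in> verts G" "x \<noteq> y" "(x, y) \<notin> arcs_ends G" by blast
  \<comment> \<open>removing all but two nonadjacent vertices shows that \<open>R\<close> is nonempty\<close>
  have "cutset G (verts G - {x, y})"
  proof -
    let ?D = "del_verts G (verts G - {x, y})"
    have vD: "verts ?D = {x, y}" using xy by (auto simp: verts_del_verts)
    have "(y, x) \<notin> arcs_ends G" using xy graph_symmetric by blast
    then have "arcs_ends ?D = {}"
      using xy adj_not_same by (auto simp: arcs_ends_del_verts)
    then have "card ((\<lambda>z. z) ` verts ?D) \<le> num_components ?D"
      by (intro graph.card_labels_le_num_components graph_del_verts) auto
    then show ?thesis using xy by (simp add: cutset_def vD)
  qed
  then have ne: "R \<noteq> {}" by (auto simp: R_def)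
  have card_pos: "0 < card S" if "cutset G S" for S
  proof -
    have "S \<noteq> {}"
    proof
      assume "S = {}"
      then have "del_verts G S = G" by (simp add: del_verts_def induce_eq_iff_induced induced_subgraph_refl)
      then show False using that conn by (simp add: cutset_def)
    qed
    then show ?thesis using that finite_subset[OF _ finite_verts] by (auto simp: cutset_def card_gt_0_iff)
  qed
  have pos: "r > 0" if "r \<in> R" for r
    using that card_pos by (auto simp: R_def cutset_def)
  have tough: "tough t G \<longleftrightarrow> t \<le> Min R" if "t > 0" for t
  proof -
    have "real (?w S) \<le> real (card S) / t \<longleftrightarrow> t \<le> real (card S) / real (?w S)" if "cutset G S" for S
      using that \<open>t > 0\<close> by (simp add: cutset_def field_simps)
    then have "tough t G \<longleftrightarrow> (\<forall>r\<in>R. t \<le> r)" by (auto simp: tough_def R_def)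
    then show ?thesis using fin ne by simp
  qed
  have "Min R > 0" using fin ne pos by simp
  then have "(GREATEST t. t > 0 \<and> tough t G) = Min R"
    using tough by (intro Greatest_equality) auto
  then have "toughness G = ereal (Min R)" using conn ncomp by (simp add: toughness_def)
  then show thesis using that \<open>Min R > 0\<close> tough by blast
qed

lemma (in graph) tough_if_toughness_eq:
  assumes "toughness G = ereal t" "t > 0"
  shows "tough t G"
proof -
  have "\<not> complete_digraph (card (verts G)) G" "num_components G < 2"
    using assms by (auto simp: toughness_def split: if_splits)
  then show ?thesis using toughness_attained assms by (metis ereal.inject order_refl)
qed

text \<open>For a disconnected graph, whose toughness is 0 by definition, the empty cutset is a witness.\<close>
lemma (in graph) cutset_if_toughness_less:
  assumes "toughness G < ereal t" "t > 0"
  obtains S where "cutset G S" "real (card S) / t < real (num_components (del_verts G S))"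
proof (cases "num_components G < 2")
  case True
  have "\<not> complete_digraph (card (verts G)) G"
    using assms by (auto simp: toughness_def)
  then obtain T where "toughness G = ereal T" "\<And>t. t > 0 \<Longrightarrow> tough t G \<longleftrightarrow> t \<le> T"
    using toughness_attained[OF True] by metis
  then have "\<not> tough t G" using assms by simp
  then show thesis using that by (auto simp: tough_def not_le)
next
  case False
  have "del_verts G {} = G" by (simp add: del_verts_def induce_eq_iff_induced induced_subgraph_refl)
  then show thesis using that[of "{}"] False by (simp add: cutset_def)
qed

lemma (in graph) claw_free_arcs_ends:
  assumes "claw_free G"
    and "(s, x) \<in> arcs_ends G" "(s, y) \<in> arcs_ends G" "(s, z) \<in> arcs_ends G"
    and "x \<noteq> y" "y \<noteq> z" "x \<noteq> z"
  shows "(x, y) \<in> arcs_ends G \<or> (y, z) \<in> arcs_ends G \<or> (x, z) \<in> arcs_ends G"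
proof (rule ccontr)
  assume no: "\<not> ?thesis"
  define T where "T = {x, y, z}"
  let ?H = "G \<restriction> insert s T"
  have star: "(s, w) \<in> arcs_ends G" "(w, s) \<in> arcs_ends G" if "w \<in> T" for w
    using that assms(2-4) graph_symmetric unfolding T_def by blast+
  have nonadj: "(u, v) \<notin> arcs_ends G" if "u \<in> T" "v \<in> T" for u v
    using that no graph_symmetric[of u v] adj_not_same unfolding T_def by blast
  have loop: "(s, s) \<notin> arcs_ends G" using adj_not_same by blast
  have verts: "insert s T \<subseteq> verts G" using star adj_in_verts assms(2) by blast
  have "arcs_ends ?H = {(u, v) \<in> arcs_ends G. u \<in> insert s T \<and> v \<in> insert s T}"
    by (auto simp: arcs_ends_conv)
  also have "\<dots> = {s} \<times> T \<union> T \<times> {s}"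
    using star nonadj loop by blast
  finally have "arcs_ends ?H = {s} \<times> T \<union> T \<times> {s}" .
  moreover have "verts ?H = {s} \<union> T" by simp
  moreover have "{s} \<inter> T = {}" using star loop by blast
  moreover have "card {s} = 1" "card T = 3" using assms(5-7) by (simp_all add: T_def)
  ultimately have "complete_bipartite_digraph 1 3 ?H"
    unfolding complete_bipartite_digraph_def using graph_induce[OF verts] by blast
  then show False using assms(1) induced_induce[OF verts] unfolding claw_free_def by blast
qed

lemma (in graph) digraph_iso_with_proj:
  assumes bij: "bij_betw f (verts G) (pverts H)"
    and adj: "parcs H = (\<lambda>(x, y). (f x, f y)) ` arcs_ends G"
  shows "digraph_iso G (with_proj H)"
proof -
  let ?h = "\<lparr>iso_verts = f, iso_arcs = \<lambda>a. (f (tail G a), f (head G a)), iso_head = snd, iso_tail = fst\<rparr>"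
  have inj: "inj_on f (verts G)" using bij by (rule bij_betw_imp_inj_on)
  have "inj_on (\<lambda>a. (f (tail G a), f (head G a))) (arcs G)"
  proof (rule inj_onI)
    fix a b assume ab: "a \<in> arcs G" "b \<in> arcs G"
      "(f (tail G a), f (head G a)) = (f (tail G b), f (head G b))"
    then show "a = b"
      using inj by (intro no_multi_arcs) (auto simp: arc_to_ends_def dest: inj_onD)
  qed
  then have "digraph_isomorphism ?h"
    using inj wf_digraph by (simp add: digraph_isomorphism_def)
  moreover have "with_proj H = app_iso ?h G"
    using bij adj by (simp add: with_proj_def app_iso_def bij_betw_def arcs_ends_conv image_image)
  ultimately show ?thesis by (auto simp: digraph_iso_def)
qed

theorem theorem1p9:
  fixes G :: "('a, 'b) pre_digraph" and n :: nat
  assumes "graph G"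
    and "card (verts G) = n"
    and "n \<ge> 4"
    and "minimally_tough 1 G"
    and "claw_free G"
  shows "digraph_iso G (with_proj (cycle_graph n))"
proof -
  interpret G: graph G by fact
  let ?V = "verts G" and ?E = "arcs_ends G"
  have tough_G: "tough 1 G"
    using assms(4) by (intro G.tough_if_toughness_eq) (auto simp: minimally_tough_def)
  have "?E \<subseteq> ?V \<times> ?V" by (rule subrelI) (simp add: G.adj_in_verts)
  have "sym ?E" using G.sym_arcs by (simp add: symmetric_def)
  have "irrefl ?E" using G.adj_not_same by (auto simp: irrefl_def)
  interpret M: minimally_one_tough_claw_free ?V ?E
  proof
    show "finite ?V" "?E \<subseteq> ?V \<times> ?V" "sym ?E" "irrefl ?E" by (rule G.finite_verts | fact)+
  next
    fix S and c :: "'a \<Rightarrow> 'a set"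
    assume S: "S \<subseteq> ?V" and c: "constant_on_edges ?E (?V - S) c" and two: "2 \<le> card (c ` (?V - S))"
    let ?D = "del_verts G S"
    have "card (c ` verts ?D) \<le> num_components ?D"
      using constant_on_edgesD[OF c]
      by (intro graph.card_labels_le_num_components G.graph_del_verts) (auto simp: arcs_ends_del_verts)
    then have le: "card (c ` (?V - S)) \<le> num_components ?D" by (simp add: verts_del_verts)
    then have "cutset G S" using S two by (simp add: cutset_def)
    then have "num_components ?D \<le> card S" using tough_G by (simp add: tough_def)
    with le show "card (c ` (?V - S)) \<le> card S" by simp
  next
    fix s x y z
    assume "(s, x) \<in> ?E" "(s, y) \<in> ?E" "(s, z) \<in> ?E" "x \<noteq> y" "y \<noteq> z" "x \<noteq> z"
    then show "(x, y) \<in> ?E \<or> (y, z) \<in> ?E \<or> (x, z) \<in> ?E"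
      by (rule G.claw_free_arcs_ends[OF assms(5)])
  next
    fix u v assume "(u, v) \<in> ?E"
    then obtain e where e: "e \<in> arcs G" "tail G e = u" "head G e = v" by blast
    interpret H: graph "del_edge G e" by (rule G.graph_del_edge)
    have "toughness (del_edge G e) < ereal 1"
      using assms(4) e(1) by (simp add: minimally_tough_def)
    then obtain S where S: "cutset (del_edge G e) S"
      "real (card S) / 1 < real (num_components (del_verts (del_edge G e) S))"
      by (rule H.cutset_if_toughness_less) simp
    interpret D: graph "del_verts (del_edge G e) S" by (rule H.graph_del_verts)
    have "constant_on_edges (?E - {(u, v), (v, u)}) (?V - S) D.scc_of"
      using D.scc_of_eq_if_adj e
      by (auto simp: constant_on_edges_def arcs_ends_del_verts arcs_ends_del_edge)
    moreover have "num_components (del_verts (del_edge G e) S) = card (D.scc_of ` (?V - S))"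
      using D.num_components_eq_card_scc_of by (simp add: verts_del_verts)
    ultimately show "\<exists>S (c :: 'a \<Rightarrow> 'a set). S \<subseteq> ?V \<and>
        constant_on_edges (?E - {(u, v), (v, u)}) (?V - S) c \<and>
        2 \<le> card (c ` (?V - S)) \<and> card S < card (c ` (?V - S))"
      using S by (intro exI[of _ S] exI[of _ D.scc_of]) (simp add: cutset_def)
  next
    show "4 \<le> card ?V" using assms(2,3) by simp
  qed
  interpret C: connected_two_regular ?V ?E
  proof
    show "?V \<noteq> {}" using assms(2,3) by auto
    show "card {x. (v, x) \<in> ?E} = 2" if "v \<in> ?V" for v using that by (rule M.degree_eq_2)
    show "\<exists>x\<in>A. \<exists>y\<in>?V - A. (x, y) \<in> ?E" if "A \<subseteq> ?V" "A \<noteq> {}" "A \<noteq> ?V" for A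
      using M.connected[OF that] by blast
  qed (rule G.finite_verts | fact)+
  obtain p where p: "distinct p" "set p = ?V" and
    adj: "\<forall>i<length p. \<forall>j<length p.
      (p ! i, p ! j) \<in> ?E \<longleftrightarrow> j = Suc i mod length p \<or> i = Suc j mod length p"
    using C.cyclic_enumeration by (elim exE conjE)
  have len: "length p = n" using p assms(2) distinct_card by metis
  define f where "f = inv_into {0..<n} ((!) p)"
  have bij: "bij_betw ((!) p) {0..<n} ?V"
    using p len by (intro bij_betw_nth) auto
  then have f: "bij_betw f ?V {0..<n}" unfolding f_def by (rule bij_betw_inv_into)
  have f_nth: "f (p ! i) = i" if "i < n" for i
    using bij_betw_inv_into_left[OF bij, of i] that by (simp add: f_def)
  have "parcs (cycle_graph n) = (\<lambda>(x, y). (f x, f y)) ` ?E"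
  proof (intro equalityI subrelI)
    fix i j assume "(i, j) \<in> parcs (cycle_graph n)"
    then have ij: "i < n" "j < n" "(p ! i, p ! j) \<in> ?E" using adj len by (auto simp: cycle_graph_def)
    show "(i, j) \<in> (\<lambda>(x, y). (f x, f y)) ` ?E"
      by (rule image_eqI[OF _ ij(3)]) (simp add: f_nth ij(1,2))
  next
    fix i j assume "(i, j) \<in> (\<lambda>(x, y). (f x, f y)) ` ?E"
    then obtain x y where xy: "(x, y) \<in> ?E" "i = f x" "j = f y" by auto
    then have "x \<in> set p" "y \<in> set p" using G.adj_in_verts p(2) by blast+
    then obtain k l where "k < n" "x = p ! k" "l < n" "y = p ! l" using len by (metis in_set_conv_nth)
    then show "(i, j) \<in> parcs (cycle_graph n)"
      using xy f_nth adj len by (simp add: cycle_graph_def)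
  qed
  then show ?thesis
    using f by (intro G.digraph_iso_with_proj) (simp_all add: cycle_graph_def)
qed

end
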